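(* Let $(\Omega,\Sigma,\mu)$ be a finite measure space and let $Y$ be a Banach space with the Radon--Nikod\'ym property. Then $\operatorname{RSE}(L_1(\mu),Y)$ is dense in $\mathcal{L}(L_1(\mu),Y)$.
   Context: Banach spaces are over $\mathbb{K}$, where $\mathbb{K}=\mathbb{R}$ or $\mathbb{C}$, and are nonzero (in particular $L_1(\mu)\neq\{0\}$). $\mathbb{T}=\{\theta\in\mathbb{K}\colon |\theta|=1\}$; $B_X$, $S_X$ are the closed unit ball and unit sphere of $X$; $\mathcal{L}(X,Y)$ is the space of bounded linear operators with the operator norm, and density is with respect to this norm. $T\in\operatorname{RSE}(X,Y)$ (range strongly exposing) means: there exists $x_0\in S_X$ such that whenever $(x_n)\subseteq B_X$ satisfies $\|Tx_n\|\to\|T\|$, there are a subsequence $(x_{\sigma(n)})$ and $\theta\in\mathbb{T}$ with $Tx_{\sigma(n)}\to\theta Tx_0$ in norm. $Y$ has the Radon--Nikod\'ym property if for every finite measure space $(\Omega',\Sigma',\nu)$, each $\nu$-continuous vector measure $G\colon\Sigma'\to Y$ of bounded variation has a Bochner integrable Radon--Nikod\'ym derivative with respect to $\nu$. *)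

theory Defs
  imports "HOL-Analysis.Analysis"
begin

section \<open>Normed spaces with explicit carrier, operators, range strongly exposing operators\<close>

text \<open>The space \<open>L\<^sub>1(\<mu>)\<close> depends on a term (the measure), so it is not a type; the domain of the
  operators is therefore a carrier set with its operations.  The codomain is a type of class
  \<^class>\<open>banach\<close> together with its multiplication by scalars from the field \<open>'k\<close>.\<close>

record ('k, 'x) nspace =
  car :: "'x set"
  add :: "'x \<Rightarrow> 'x \<Rightarrow> 'x"
  scl :: "'k \<Rightarrow> 'x \<Rightarrow> 'x"
  nrm :: "'x \<Rightarrow> real"

definition nonzero_space :: "('k, 'x) nspace \<Rightarrow> bool" where
  "nonzero_space X \<longleftrightarrow> (\<exists>x\<in>car X. nrm X x \<noteq> 0)"

text \<open>A \<open>'k\<close>-normed space structure on a real normed space, inducing its given real structure.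
  For \<open>'k = real\<close> the only one is \<^const>\<open>scaleR\<close>; for \<open>'k = complex\<close> and \<open>'y\<close> complete, this makes
  \<open>'y\<close> a complex Banach space.\<close>

definition normed_scaling :: "('k::real_normed_field \<Rightarrow> 'y::real_normed_vector \<Rightarrow> 'y) \<Rightarrow> bool" where
  "normed_scaling s \<longleftrightarrow> vector_space s
     \<and> (\<forall>c y. norm (s c y) = norm c * norm y)
     \<and> (\<forall>r y. s (of_real r) y = r *\<^sub>R y)"

text \<open>Only the values of an operator on the carrier matter.\<close>

definition bdd_operators ::
    "('k, 'x) nspace \<Rightarrow> ('k \<Rightarrow> 'y::real_normed_vector \<Rightarrow> 'y) \<Rightarrow> ('x \<Rightarrow> 'y) set" where
  "bdd_operators X s = {T.
     (\<forall>u\<in>car X. \<forall>v\<in>car X. T (add X u v) = T u + T v)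
     \<and> (\<forall>c. \<forall>u\<in>car X. T (scl X c u) = s c (T u))
     \<and> (\<exists>C. \<forall>u\<in>car X. norm (T u) \<le> C * nrm X u)}"

definition op_norm :: "('k, 'x) nspace \<Rightarrow> ('x \<Rightarrow> 'y::real_normed_vector) \<Rightarrow> real" where
  "op_norm X T = (SUP u\<in>{u \<in> car X. nrm X u \<le> 1}. norm (T u))"

definition RSE ::
    "('k::real_normed_field, 'x) nspace \<Rightarrow> ('k \<Rightarrow> 'y::real_normed_vector \<Rightarrow> 'y) \<Rightarrow> ('x \<Rightarrow> 'y) set" where
  "RSE X s = {T \<in> bdd_operators X s.
     \<exists>x0\<in>car X. nrm X x0 = 1 \<and>
       (\<forall>x :: nat \<Rightarrow> 'x.
          (\<forall>n. x n \<in> car X \<and> nrm X (x n) \<le> 1) \<and> (\<lambda>n. norm (T (x n))) \<longlonglongrightarrow> op_norm X T \<longrightarrow>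
          (\<exists>\<sigma> :: nat \<Rightarrow> nat. \<exists>\<theta> :: 'k. strict_mono \<sigma> \<and> norm \<theta> = 1 \<and>
             (\<lambda>n. T (x (\<sigma> n))) \<longlonglongrightarrow> s \<theta> (T x0)))}"

definition op_norm_dense ::
    "('k, 'x) nspace \<Rightarrow> ('x \<Rightarrow> 'y::real_normed_vector) set \<Rightarrow> ('x \<Rightarrow> 'y) set \<Rightarrow> bool" where
  "op_norm_dense X D L \<longleftrightarrow> D \<subseteq> L \<and>
     (\<forall>T\<in>L. \<forall>\<epsilon>>0. \<exists>S\<in>D. op_norm X (\<lambda>u. T u - S u) < \<epsilon>)"

section \<open>The space \<open>L\<^sub>1(\<mu>)\<close> of classes of integrable functions\<close>

definition ae_eq ::
    "'a measure \<Rightarrow> (('a \<Rightarrow> 'k::{real_normed_field, banach, second_countable_topology}) \<times> ('a \<Rightarrow> 'k)) set"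
  where
  "ae_eq M = {(f, g). integrable M f \<and> integrable M g \<and> (AE x in M. f x = g x)}"

definition L1 ::
    "'a measure \<Rightarrow> ('k::{real_normed_field, banach, second_countable_topology}, ('a \<Rightarrow> 'k) set) nspace"
  where
  "L1 M = \<lparr>
     car = {f. integrable M f} // ae_eq M,
     add = (\<lambda>u v. \<Union>f\<in>u. \<Union>g\<in>v. ae_eq M `` {\<lambda>x. f x + g x}),
     scl = (\<lambda>c u. \<Union>f\<in>u. ae_eq M `` {\<lambda>x. c * f x}),
     nrm = (\<lambda>u. the_elem ((\<lambda>f. \<integral>x. norm (f x) \<partial>M) ` u)) \<rparr>"

lemma equiv_ae_eq: "equiv {f. integrable M f} (ae_eq M)"
  by (rule equivI) (auto simp: ae_eq_def refl_on_def sym_def trans_def elim: AE_mp)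

lemma L1_car: "u \<in> car (L1 M) \<longleftrightarrow> (\<exists>f. integrable M f \<and> u = ae_eq M `` {f})"
  by (auto simp: L1_def quotient_def)

lemma L1_nrm:
  assumes "integrable M f"
  shows "nrm (L1 M) (ae_eq M `` {f}) = (\<integral>x. norm (f x) \<partial>M)"
proof -
  have "(\<integral>x. norm (g x) \<partial>M) = (\<integral>x. norm (f x) \<partial>M)" if "g \<in> ae_eq M `` {f}" for g
    using that by (intro integral_cong_AE) (auto simp: ae_eq_def)
  moreover have "f \<in> ae_eq M `` {f}"
    using assms by (simp add: ae_eq_def)
  ultimately have "(\<lambda>g. \<integral>x. norm (g x) \<partial>M) ` (ae_eq M `` {f}) = {\<integral>x. norm (f x) \<partial>M}"
    by blast
  then show ?thesis
    by (simp add: L1_def)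
qed

lemma L1_add:
  assumes "integrable M f" "integrable M g"
  shows "add (L1 M) (ae_eq M `` {f}) (ae_eq M `` {g}) = ae_eq M `` {\<lambda>x. f x + g x}"
proof -
  have "ae_eq M `` {\<lambda>x. f' x + g' x} = ae_eq M `` {\<lambda>x. f x + g x}"
    if "f' \<in> ae_eq M `` {f}" "g' \<in> ae_eq M `` {g}" for f' g'
    using that by (intro equiv_class_eq[OF equiv_ae_eq]) (auto simp: ae_eq_def elim: AE_mp)
  moreover have "f \<in> ae_eq M `` {f}" "g \<in> ae_eq M `` {g}"
    using assms by (simp_all add: ae_eq_def)
  ultimately show ?thesis
    unfolding L1_def nspace.simps by blast
qed

lemma L1_scl:
  assumes "integrable M f"
  shows "scl (L1 M) c (ae_eq M `` {f}) = ae_eq M `` {\<lambda>x. c * f x}"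
proof -
  have "ae_eq M `` {\<lambda>x. c * f' x} = ae_eq M `` {\<lambda>x. c * f x}" if "f' \<in> ae_eq M `` {f}" for f'
  proof (rule equiv_class_eq[OF equiv_ae_eq])
    have "AE x in M. f x = f' x"
      using that by (simp add: ae_eq_def)
    then have "AE x in M. c * f' x = c * f x"
      by (rule eventually_mono) simp
    then show "(\<lambda>x. c * f' x, \<lambda>x. c * f x) \<in> ae_eq M"
      using that by (simp add: ae_eq_def del: mult_cancel_left)
  qed
  moreover have "f \<in> ae_eq M `` {f}"
    using assms by (simp add: ae_eq_def)
  ultimately show ?thesis
    unfolding L1_def nspace.simps by blast
qed

section \<open>The Radon--Nikodym property\<close>

text \<open>The defining clause of \<^const>\<open>has_bochner_integral\<close>, without the restriction of the
  library to second countable (separable) value spaces.  The approximability by simple functions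
  makes \<open>f\<close> strongly measurable up to a null set.\<close>

definition has_Bochner :: "'w measure \<Rightarrow> ('w \<Rightarrow> 'y::real_normed_vector) \<Rightarrow> 'y \<Rightarrow> bool" where
  "has_Bochner N f y \<longleftrightarrow> f \<in> borel_measurable N \<and>
     (\<exists>s. (\<forall>i::nat. Bochner_Integration.simple_bochner_integrable N (s i))
        \<and> (\<lambda>i. \<integral>\<^sup>+x. norm (f x - s i x) \<partial>N) \<longlonglongrightarrow> 0
        \<and> (\<lambda>i. Bochner_Integration.simple_bochner_integral N (s i)) \<longlonglongrightarrow> y)"

lemma has_Bochner_eq_library:
  fixes f :: "'w \<Rightarrow> 'y::{real_normed_vector, second_countable_topology}"
  shows "has_Bochner N f y \<longleftrightarrow> has_bochner_integral N f y"
  unfolding has_Bochner_def has_bochner_integral.simps by auto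

definition vector_measure :: "'w measure \<Rightarrow> ('w set \<Rightarrow> 'y::real_normed_vector) \<Rightarrow> bool" where
  "vector_measure N G \<longleftrightarrow>
     (\<forall>A :: nat \<Rightarrow> 'w set. range A \<subseteq> sets N \<and> disjoint_family A \<longrightarrow>
        (\<lambda>n. G (A n)) sums G (\<Union>n. A n))"

definition bounded_variation :: "'w measure \<Rightarrow> ('w set \<Rightarrow> 'y::real_normed_vector) \<Rightarrow> bool" where
  "bounded_variation N G \<longleftrightarrow>
     (\<exists>B. \<forall>P. finite P \<and> P \<subseteq> sets N \<and> partition_on (space N) P \<longrightarrow> (\<Sum>A\<in>P. norm (G A)) \<le> B)"

definition abs_cont :: "'w measure \<Rightarrow> ('w set \<Rightarrow> 'y::real_normed_vector) \<Rightarrow> bool" where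
  "abs_cont N G \<longleftrightarrow>
     (\<forall>\<epsilon>>0. \<exists>\<delta>>0. \<forall>A\<in>sets N. measure N A < \<delta> \<longrightarrow> norm (G A) < \<epsilon>)"

text \<open>HOL cannot quantify over all carrier types inside a formula, so the type \<open>'w\<close> of the points
  of the measure spaces is a parameter.  For \<open>A = space N\<close> the conclusion says that \<open>g\<close> itself is
  Bochner integrable.  The property over \<^typ>\<open>real\<close> is already equivalent to the one over all
  types (Lebesgue measure on \<open>[0,1]\<close> suffices as a test space).\<close>

definition RNP_on :: "'w itself \<Rightarrow> 'y::banach itself \<Rightarrow> bool" where
  "RNP_on _ _ \<longleftrightarrow>
     (\<forall>(N :: 'w measure) (G :: 'w set \<Rightarrow> 'y).
        finite_measure N \<and> vector_measure N G \<and> abs_cont N G \<and> bounded_variation N G \<longrightarrow>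
        (\<exists>g. \<forall>A\<in>sets N. has_Bochner N (\<lambda>x. indicator A x *\<^sub>R g x) (G A)))"

end

theory Submission
  imports Defs
begin

text \<open>
  Let \<open>T\<close> be a bounded operator on \<open>L\<^sub>1(\<mu>)\<close>. The vector measure \<open>A \<mapsto> T 1\<^sub>A\<close> satisfies
  \<open>\<parallel>T 1\<^sub>A\<parallel> \<le> C \<mu>(A)\<close>, so the Radon--Nikodym property provides a Bochner density \<open>g\<close>, and \<open>T\<close> is
  integration against \<open>g\<close>; its norm is the essential supremum of \<open>\<parallel>g\<parallel>\<close>. Being strongly
  measurable, \<open>g\<close> is within \<open>d\<close> of a constant \<open>y\<close> on some set \<open>A\<close> of positive measure on which
  \<open>\<parallel>g\<parallel>\<close> almost attains that supremum (\<open>density_near_constant\<close>).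

  Replace \<open>g\<close> on \<open>A\<close> by a vector \<open>y'\<close> that is close to \<open>y\<close> and whose norm exceeds the norm bound
  of \<open>T\<close>. The new operator \<open>V\<close> is close to \<open>T\<close>, and mass of a function outside \<open>A\<close> contributes
  strictly less to \<open>\<parallel>V f\<parallel>\<close> than mass inside \<open>A\<close>. A sequence of \<open>f\<close> in the unit ball that is norming
  for \<open>V\<close> must therefore lose its mass outside \<open>A\<close>, and its integrals over \<open>A\<close> approach the unit
  sphere of the scalar field; by compactness they subconverge to some \<open>\<theta>\<close> there, and then \<open>V f\<close>
  subconverges to \<open>\<theta> y' = \<theta> V (1\<^sub>A / \<mu>(A))\<close> (\<open>peaking_operator\<close>). Hence \<open>V\<close> is range strongly
  exposing.

  All estimates are made on the operators themselves: those on indicators extend to all integrable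
  functions by density of the simple functions (\<open>norm_le\<close>), and on indicators they come from
  comparing the Bochner integral of \<open>g\<close> with that of a constant (\<open>has_Bochner_norm_diff_le\<close>). The
  argument is the same for real and complex scalars; what it uses of the field is local compactness.
\<close>

section \<open>Bochner integrals in possibly nonseparable spaces\<close>

text \<open>In a nonseparable space the difference of two Borel functions need not be Borel. Subtracting
  a function with finitely many values is harmless, because on each of its level sets it is a
  continuous operation.\<close>

lemma borel_measurable_norm_diff_simple:
  fixes f t :: "'w \<Rightarrow> 'y::real_normed_vector"
  assumes f: "f \<in> borel_measurable N" and t: "simple_function N t"
  shows "(\<lambda>x. norm (f x - t x)) \<in> borel_measurable N"
proof -
  have "(\<lambda>x. norm (f x - v)) \<in> borel_measurable N" for v
  proof (rule measurable_compose[OF f])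
    show "(\<lambda>y. norm (y - v)) \<in> borel_measurable borel"
      by (intro borel_measurable_continuous_onI continuous_intros)
  qed
  moreover have "t \<in> measurable N (count_space (t ` space N))"
    using measurable_simple_function[OF t] by (auto simp: measurable_def)
  moreover have "countable (t ` space N)"
    using t by (auto simp: simple_function_def countable_finite)
  ultimately show ?thesis
    by (rule measurable_compose_countable'[where f = "\<lambda>v x. norm (f x - v)"])
qed

text \<open>For a simple function in place of \<open>f\<close> this is the triangle inequality; it passes to the limit
  along the simple functions that define the integral of \<open>f\<close>. The density
  of an operator is controlled through the instances \<open>t = 0\<close> and \<open>t\<close> constant on a set.\<close>

lemma has_Bochner_norm_diff_le:
  fixes f t :: "'w \<Rightarrow> 'y::real_normed_vector"
  assumes f: "has_Bochner N f y" and t: "Bochner_Integration.simple_bochner_integrable N t"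
  shows "ennreal (norm (y - Bochner_Integration.simple_bochner_integral N t))
           \<le> (\<integral>\<^sup>+x. norm (f x - t x) \<partial>N)"
proof -
  let ?sbi = "Bochner_Integration.simple_bochner_integral N"
  obtain s where fm: "f \<in> borel_measurable N"
    and s: "\<And>i::nat. Bochner_Integration.simple_bochner_integrable N (s i)"
    and s0: "(\<lambda>i. \<integral>\<^sup>+x. norm (f x - s i x) \<partial>N) \<longlonglongrightarrow> 0"
    and sy: "(\<lambda>i. ?sbi (s i)) \<longlonglongrightarrow> y"
    using f unfolding has_Bochner_def by blast
  have sf: "simple_function N (s i)" "simple_function N t" for i
    using s t by (auto simp: Bochner_Integration.simple_bochner_integrable.simps)
  have bd: "ennreal (norm (?sbi (s i) - ?sbi t))
          \<le> (\<integral>\<^sup>+x. norm (f x - s i x) \<partial>N) + (\<integral>\<^sup>+x. norm (f x - t x) \<partial>N)" for i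
  proof -
    have st: "Bochner_Integration.simple_bochner_integrable N (\<lambda>x. s i x - t x)"
      "Bochner_Integration.simple_bochner_integrable N (\<lambda>x. norm (s i x - t x))"
      using Bochner_Integration.simple_bochner_integrable_compose2[OF _ s t, of "\<lambda>x y. x - y"]
        Bochner_Integration.simple_bochner_integrable_compose2[OF _ s t, of "\<lambda>x y. norm (x - y)"]
      by simp_all
    have "ennreal (norm (?sbi (s i) - ?sbi t)) = norm (?sbi (\<lambda>x. s i x - t x))"
      using Bochner_Integration.simple_bochner_integral_diff[OF s t] by simp
    also have "\<dots> \<le> Bochner_Integration.simple_bochner_integral N (\<lambda>x. norm (s i x - t x))"
      by (intro ennreal_leI Bochner_Integration.simple_bochner_integral_norm_bound st)
    also have "\<dots> = (\<integral>\<^sup>+x. norm (s i x - t x) \<partial>N)"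
      by (intro Bochner_Integration.simple_bochner_integral_eq_nn_integral st) simp
    also have "\<dots> \<le> (\<integral>\<^sup>+x. ennreal (norm (f x - s i x)) + ennreal (norm (f x - t x)) \<partial>N)"
    proof (intro nn_integral_mono)
      fix x
      have "norm (s i x - t x) \<le> norm (f x - s i x) + norm (f x - t x)"
        by (metis dual_order.refl norm_diff_triangle_le norm_minus_commute)
      then show "ennreal (norm (s i x - t x)) \<le> ennreal (norm (f x - s i x)) + ennreal (norm (f x - t x))"
        by (metis ennreal_leI ennreal_plus norm_ge_zero)
    qed
    also have "\<dots> = (\<integral>\<^sup>+x. norm (f x - s i x) \<partial>N) + (\<integral>\<^sup>+x. norm (f x - t x) \<partial>N)"
      using borel_measurable_norm_diff_simple[OF fm] sf by (intro nn_integral_add) auto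
    finally show ?thesis .
  qed
  have "(\<lambda>i. ennreal (norm (?sbi (s i) - ?sbi t))) \<longlonglongrightarrow> ennreal (norm (y - ?sbi t))"
    by (intro tendsto_ennrealI tendsto_intros sy)
  moreover have "(\<lambda>i. (\<integral>\<^sup>+x. norm (f x - s i x) \<partial>N) + (\<integral>\<^sup>+x. norm (f x - t x) \<partial>N))
      \<longlonglongrightarrow> 0 + (\<integral>\<^sup>+x. norm (f x - t x) \<partial>N)"
    by (intro tendsto_intros s0)
  ultimately show ?thesis
    using LIMSEQ_le bd by (metis (no_types, lifting) add.left_neutral)
qed

section \<open>Operators on integrable functions\<close>

text \<open>Operators on \<open>L\<^sub>1(\<mu>)\<close>, seen as maps on integrable functions instead of classes: cutting a
  function to a set and adding functions are then literal, and the bound forces the values to depend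
  only on the class (\<open>cong_AE\<close> below). The sort of \<open>'k\<close> covers the reals and the complex numbers, and
  makes bounded sets of scalars relatively compact.\<close>

locale L1_operator = finite_measure M
  for M :: "'a measure" +
  fixes s :: "'k::{real_normed_field, euclidean_space} \<Rightarrow> 'y::banach \<Rightarrow> 'y"
    and U :: "('a \<Rightarrow> 'k) \<Rightarrow> 'y"
  assumes scaling: "normed_scaling s"
    and add: "integrable M f \<Longrightarrow> integrable M g \<Longrightarrow> U (\<lambda>x. f x + g x) = U f + U g"
    and scale: "integrable M f \<Longrightarrow> U (\<lambda>x. c * f x) = s c (U f)"
    and bounded: "\<exists>C. \<forall>f. integrable M f \<longrightarrow> norm (U f) \<le> C * (\<integral>x. norm (f x) \<partial>M)"
begin

lemma bound:
  obtains C where "C \<ge> 0" "\<And>f. integrable M f \<Longrightarrow> norm (U f) \<le> C * (\<integral>x. norm (f x) \<partial>M)"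
proof -
  obtain C where C: "\<And>f. integrable M f \<Longrightarrow> norm (U f) \<le> C * (\<integral>x. norm (f x) \<partial>M)"
    using bounded by blast
  have "norm (U f) \<le> \<bar>C\<bar> * (\<integral>x. norm (f x) \<partial>M)" if "integrable M f" for f
    using C[OF that] by (meson Bochner_Integration.integral_nonneg abs_ge_self mult_right_mono norm_ge_zero order_trans)
  then show ?thesis
    using that[of "\<bar>C\<bar>"] by auto
qed

lemma s_norm: "norm (s c y) = norm c * norm y"
  and s_of_real: "s (of_real r) y = r *\<^sub>R y"
  and s_vs: "vector_space s"
  using scaling by (auto simp: normed_scaling_def)

lemma s_add_left: "s (a + b) y = s a y + s b y"
  and s_add_right: "s a (y + z) = s a y + s a z"
  and s_mult: "s (a * b) y = s a (s b y)"
  using s_vs by (auto simp: vector_space_def)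

lemma s_diff_left: "s (a - b) y = s a y - s b y"
  using s_add_left[of "a - b" b y] by simp

lemma s_diff_right: "s a (y - z) = s a y - s a z"
  using s_add_right[of a "y - z" z] by simp

lemma diff: "integrable M f \<Longrightarrow> integrable M g \<Longrightarrow> U (\<lambda>x. f x - g x) = U f - U g"
  using add[of "\<lambda>x. f x - g x" g] by simp

lemma zero: "U (\<lambda>x. 0) = 0"
  using add[of "\<lambda>x. 0" "\<lambda>x. 0"] by simp

lemma cong_AE:
  assumes "integrable M f" "integrable M g" "AE x in M. f x = g x"
  shows "U f = U g"
proof -
  obtain C where C: "\<And>f. integrable M f \<Longrightarrow> norm (U f) \<le> C * (\<integral>x. norm (f x) \<partial>M)"
    using bound by blast
  have "(\<integral>x. norm (f x - g x) \<partial>M) = 0"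
    using assms by (intro integral_eq_zero_AE) auto
  then show ?thesis
    using C[of "\<lambda>x. f x - g x"] assms by (simp add: diff)
qed

lemma cong:
  assumes "integrable M f" "\<And>x. x \<in> space M \<Longrightarrow> f x = g x"
  shows "U f = U g"
  using assms by (intro cong_AE) (auto cong: Bochner_Integration.integrable_cong)

lemma sum: "finite I \<Longrightarrow> (\<And>i. i \<in> I \<Longrightarrow> integrable M (f i)) \<Longrightarrow> U (\<lambda>x. \<Sum>i\<in>I. f i x) = (\<Sum>i\<in>I. U (f i))"
proof (induction I rule: finite_induct)
  case (insert i I)
  then have "U (\<lambda>x. \<Sum>i\<in>insert i I. f i x) = U (\<lambda>x. f i x + (\<Sum>i\<in>I. f i x))"
    by simp
  also have "\<dots> = U (f i) + U (\<lambda>x. \<Sum>i\<in>I. f i x)"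
    using insert by (intro add) auto
  finally show ?case
    using insert by simp
qed (simp add: zero)

lemma integrable_indicator_field:
  assumes "B \<in> sets M"
  shows "integrable M (indicator B :: 'a \<Rightarrow> 'k)"
proof -
  have "(indicator B :: 'a \<Rightarrow> 'k) = (\<lambda>x. indicat_real B x *\<^sub>R 1)"
    by (auto simp: indicator_def)
  then show ?thesis
    using assms by (simp add: emeasure_eq_measure)
qed

lemma integral_indicator_field:
  assumes B: "B \<in> sets M"
  shows "(\<integral>x. (indicator B x :: 'k) \<partial>M) = of_real (measure M B)"
proof -
  have "(indicator B :: 'a \<Rightarrow> 'k) = (\<lambda>x. of_real (indicat_real B x))"
    by (auto simp: indicator_def)
  moreover have "(\<integral>x. (of_real (indicat_real B x) :: 'k) \<partial>M) = of_real (\<integral>x. indicat_real B x \<partial>M)"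
    using B by (intro integral_of_real integrable_real_indicator) (auto simp: emeasure_eq_measure)
  moreover have "(\<integral>x. indicat_real B x \<partial>M) = measure M B"
    using B sets.sets_into_space[OF B] by (simp add: Int_absorb2)
  ultimately show ?thesis
    by (simp only:)
qed

text \<open>A simple function is a combination of indicators of disjoint sets, so its norm is the
  corresponding combination of measures.\<close>

lemma norm_simple_le:
  assumes ind: "\<And>B. B \<in> sets M \<Longrightarrow> norm (U (indicator B)) \<le> K * measure M B"
    and t: "simple_function M t"
  shows "norm (U t) \<le> K * (\<integral>x. norm (t x) \<partial>M)"
proof -
  let ?B = "\<lambda>v. t -` {v} \<inter> space M"
  have fin: "finite (t ` space M)" and B: "\<And>v. ?B v \<in> sets M"
    using t by (auto simp: simple_functionD)
  have int: "integrable M (\<lambda>x. v * indicator (?B v) x)" for v :: 'k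
    using B[of v] by (intro integrable_mult_right integrable_indicator_field)
  have int': "integrable M (\<lambda>x. norm v * indicator (?B v) x)" for v :: 'k
    using B[of v] by (intro integrable_mult_right integrable_real_indicator) (auto simp: emeasure_eq_measure)
  have dec: "h (t x) = (\<Sum>v\<in>t ` space M. h v * indicator (?B v) x)"
    if "x \<in> space M" for x and h :: "'k \<Rightarrow> 'c::comm_ring_1"
  proof -
    have "(\<Sum>v\<in>t ` space M. h v * indicator (?B v) x) = (\<Sum>v\<in>{t x}. h v * indicator (?B v) x)"
      using that fin by (intro sum.mono_neutral_right) (auto simp: indicator_def)
    then show ?thesis
      using that by simp
  qed
  have "U t = U (\<lambda>x. \<Sum>v\<in>t ` space M. v * indicator (?B v) x)"
    by (intro cong[symmetric] Bochner_Integration.integrable_sum int dec[symmetric])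
  also have "\<dots> = (\<Sum>v\<in>t ` space M. s v (U (indicator (?B v))))"
    using fin int B
    by (subst sum) (auto intro!: sum.cong scale integrable_indicator_field)
  also have "norm \<dots> \<le> (\<Sum>v\<in>t ` space M. norm v * (K * measure M (?B v)))"
    using B by (intro norm_sum[THEN order_trans] sum_mono) (auto simp: s_norm intro!: mult_left_mono ind)
  also have "\<dots> = K * (\<Sum>v\<in>t ` space M. \<integral>x. norm v * indicator (?B v) x \<partial>M)"
    using B sets.sets_into_space[OF B] by (simp add: sum_distrib_left mult_ac Int_absorb2)
  also have "(\<Sum>v\<in>t ` space M. \<integral>x. norm v * indicator (?B v) x \<partial>M)
      = (\<integral>x. (\<Sum>v\<in>t ` space M. norm v * indicator (?B v) x) \<partial>M)"
    using int' by (subst Bochner_Integration.integral_sum) auto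
  also have "\<dots> = (\<integral>x. norm (t x) \<partial>M)"
    by (intro Bochner_Integration.integral_cong refl dec[symmetric])
  finally show ?thesis .
qed

text \<open>The essential bound of an operator is visible on indicators. This serves both to show that the
  density must be large somewhere (where \<open>U\<close> is the given operator) and to show that the perturbed
  operator is close (where \<open>U\<close> is the difference of two operators).\<close>

lemma norm_le:
  assumes ind: "\<And>B. B \<in> sets M \<Longrightarrow> norm (U (indicator B)) \<le> K * measure M B"
    and f: "integrable M f"
  shows "norm (U f) \<le> K * (\<integral>x. norm (f x) \<partial>M)"
proof -
  obtain C where C0: "C \<ge> 0" and C: "\<And>f. integrable M f \<Longrightarrow> norm (U f) \<le> C * (\<integral>x. norm (f x) \<partial>M)"
    using bound by blast
  from f obtain y where "has_bochner_integral M f y"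
    using has_bochner_integral_integrable by blast
  then obtain t where fm[measurable]: "f \<in> borel_measurable M"
    and t: "\<And>i::nat. Bochner_Integration.simple_bochner_integrable M (t i)"
    and t0: "(\<lambda>i. \<integral>\<^sup>+x. norm (f x - t i x) \<partial>M) \<longlonglongrightarrow> 0"
    by (auto elim!: has_bochner_integral.cases)
  have ti: "integrable M (t i)" and ts: "simple_function M (t i)" for i
    using t[of i] has_bochner_integral_simple_bochner_integrable[OF t[of i]]
    by (auto simp: integrable.simps Bochner_Integration.simple_bochner_integrable.simps)
  have d0: "(\<lambda>i. \<integral>x. norm (f x - t i x) \<partial>M) \<longlonglongrightarrow> 0"
  proof -
    have "(\<integral>\<^sup>+x. norm (f x - t i x) \<partial>M) = ennreal (\<integral>x. norm (f x - t i x) \<partial>M)" for i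
      using f ti by (intro nn_integral_eq_integral) auto
    then show ?thesis
      using t0 tendsto_ennreal_iff[of "\<lambda>i. \<integral>x. norm (f x - t i x) \<partial>M" sequentially 0]
      by (simp add: zero_ennreal_def)
  qed
  let ?d = "\<lambda>i. \<integral>x. norm (f x - t i x) \<partial>M"
  have "norm (U f) \<le> K * (\<integral>x. norm (f x) \<partial>M) + (\<bar>K\<bar> + C) * ?d i" for i
  proof -
    have "norm (U f) \<le> norm (U (t i)) + norm (U (\<lambda>x. f x - t i x))"
      using f ti by (simp add: diff) (metis norm_triangle_sub)
    also have "norm (U (t i)) \<le> K * (\<integral>x. norm (t i x) \<partial>M)"
      by (rule norm_simple_le[OF ind ts])
    also have "norm (U (\<lambda>x. f x - t i x)) \<le> C * ?d i"
      using f ti by (intro C) auto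
    also have "K * (\<integral>x. norm (t i x) \<partial>M) \<le> K * (\<integral>x. norm (f x) \<partial>M) + \<bar>K\<bar> * ?d i"
    proof -
      have "\<bar>(\<integral>x. norm (t i x) \<partial>M) - (\<integral>x. norm (f x) \<partial>M)\<bar> = \<bar>\<integral>x. norm (t i x) - norm (f x) \<partial>M\<bar>"
        using f ti by (subst Bochner_Integration.integral_diff) auto
      also have "\<dots> \<le> (\<integral>x. \<bar>norm (t i x) - norm (f x)\<bar> \<partial>M)"
        by (rule integral_abs_bound)
      also have "\<dots> \<le> ?d i"
        using f ti by (intro integral_mono) (auto simp: norm_triangle_ineq3 norm_minus_commute[of "f _"])
      finally have "\<bar>K\<bar> * \<bar>(\<integral>x. norm (t i x) \<partial>M) - (\<integral>x. norm (f x) \<partial>M)\<bar> \<le> \<bar>K\<bar> * ?d i"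
        by (intro mult_left_mono) auto
      then show ?thesis
        unfolding abs_mult[symmetric] by (auto simp: algebra_simps)
    qed
    finally show ?thesis
      by (simp add: algebra_simps)
  qed
  moreover have "(\<lambda>i. K * (\<integral>x. norm (f x) \<partial>M) + (\<bar>K\<bar> + C) * ?d i)
      \<longlonglongrightarrow> K * (\<integral>x. norm (f x) \<partial>M) + (\<bar>K\<bar> + C) * 0"
    by (intro tendsto_intros d0)
  ultimately show ?thesis
    using LIMSEQ_le_const by (metis (no_types, lifting) add.right_neutral mult_zero_right)
qed

lemma norm_indicator: 
  assumes C: "\<And>f. integrable M f \<Longrightarrow> norm (U f) \<le> C * (\<integral>x. norm (f x) \<partial>M)" and B: "B \<in> sets M"
  shows "norm (U (indicator B)) \<le> C * measure M B"
proof -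
  have "(\<integral>x. norm (indicator B x :: 'k) \<partial>M) = (\<integral>x. indicator B x \<partial>M)"
    by (intro Bochner_Integration.integral_cong) (auto simp: indicator_def)
  then show ?thesis
    using C[OF integrable_indicator_field[OF B]] B sets.sets_into_space[OF B] by (simp add: Int_absorb2)
qed

section \<open>The vector measure of an operator\<close>

text \<open>The remainder of the series is the value at a tail of the union, whose measure tends to
  zero.\<close>

lemma vector_measure: "vector_measure M (\<lambda>A. U (indicator A))"
  unfolding vector_measure_def
proof safe
  fix A :: "nat \<Rightarrow> 'a set"
  assume A: "range A \<subseteq> sets M" and dis: "disjoint_family A"
  obtain C where C0: "C \<ge> 0" and C: "\<And>f. integrable M f \<Longrightarrow> norm (U f) \<le> C * (\<integral>x. norm (f x) \<partial>M)"
    using bound by blast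
  let ?X = "\<Union>n. A n"
  have X: "?X \<in> sets M" "\<And>n. A n \<in> sets M"
    using A by auto
  have bd: "norm ((\<Sum>k<n. U (indicator (A k))) - U (indicator ?X))
           \<le> C * (measure M ?X - (\<Sum>k<n. measure M (A k)))" for n
  proof -
    let ?Y = "\<Union>k<n. A k"
    have Y: "?Y \<in> sets M"
      using X by auto
    have dn: "disjoint_family_on A {..<n}"
      using dis by (rule disjoint_family_on_mono[rotated]) auto
    have "indicator ?Y x = (\<Sum>k<n. indicator (A k) x :: 'k)" for x
      using indicator_UN_disjoint[OF _ dn, of x] by simp
    then have "(indicator ?Y :: 'a \<Rightarrow> 'k) = (\<lambda>x. \<Sum>k<n. indicator (A k) x)"
      by blast
    then have "U (indicator ?Y) = (\<Sum>k<n. U (indicator (A k)))"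
      using sum[of "{..<n}" "\<lambda>k. indicator (A k)"] X integrable_indicator_field by simp
    moreover have "indicator (?X - ?Y) = (\<lambda>x. indicator ?X x - indicator ?Y x :: 'k)"
      by (auto simp: indicator_def fun_eq_iff)
    then have "U (indicator (?X - ?Y)) = U (indicator ?X) - U (indicator ?Y)"
      using diff integrable_indicator_field X Y by metis
    moreover have "measure M (?X - ?Y) = measure M ?X - (\<Sum>k<n. measure M (A k))"
      using X Y dn by (subst finite_measure_Diff) (auto intro!: finite_measure_finite_Union)
    ultimately show ?thesis
      using norm_indicator[OF C, of "?X - ?Y"] X Y by (simp add: norm_minus_commute)
  qed
  have "(\<lambda>n. \<Sum>k<n. measure M (A k)) \<longlonglongrightarrow> measure M ?X"
    using finite_measure_UNION[OF A dis] by (simp add: sums_def)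
  then have "(\<lambda>n. C * (measure M ?X - (\<Sum>k<n. measure M (A k)))) \<longlonglongrightarrow> C * (measure M ?X - measure M ?X)"
    by (intro tendsto_intros)
  then have "(\<lambda>n. C * (measure M ?X - (\<Sum>k<n. measure M (A k)))) \<longlonglongrightarrow> 0"
    by simp
  with always_eventually[OF allI[OF bd]]
  have "(\<lambda>n. (\<Sum>k<n. U (indicator (A k))) - U (indicator ?X)) \<longlonglongrightarrow> 0"
    by (rule Lim_null_comparison)
  then show "(\<lambda>n. U (indicator (A n))) sums U (indicator ?X)"
    by (simp add: sums_def LIM_zero_iff)
qed

lemma abs_cont: "abs_cont M (\<lambda>A. U (indicator A))"
  unfolding abs_cont_def
proof safe
  fix e :: real assume "e > 0"
  obtain C where C0: "C \<ge> 0" and C: "\<And>f. integrable M f \<Longrightarrow> norm (U f) \<le> C * (\<integral>x. norm (f x) \<partial>M)"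
    using bound by blast
  have "norm (U (indicator A)) < e" if A: "A \<in> sets M" "measure M A < e / (C + 1)" for A
  proof -
    have "norm (U (indicator A)) \<le> C * measure M A"
      using norm_indicator[OF C] A by blast
    also have "\<dots> \<le> (C + 1) * measure M A"
      by (simp add: mult_right_mono)
    also have "\<dots> < e"
      using A C0 by (simp add: field_simps)
    finally show ?thesis .
  qed
  then show "\<exists>d>0. \<forall>A\<in>sets M. measure M A < d \<longrightarrow> norm (U (indicator A)) < e"
    using \<open>e > 0\<close> C0 by (intro exI[of _ "e / (C + 1)"]) auto
qed

lemma bounded_variation: "bounded_variation M (\<lambda>A. U (indicator A))"
  unfolding bounded_variation_def
proof -
  obtain C where C0: "C \<ge> 0" and C: "\<And>f. integrable M f \<Longrightarrow> norm (U f) \<le> C * (\<integral>x. norm (f x) \<partial>M)"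
    using bound by blast
  have "(\<Sum>A\<in>P. norm (U (indicator A))) \<le> C * measure M (space M)"
    if P: "finite P" "P \<subseteq> sets M" "partition_on (space M) P" for P
  proof -
    have "(\<Sum>A\<in>P. norm (U (indicator A))) \<le> (\<Sum>A\<in>P. C * measure M A)"
      using P by (intro sum_mono norm_indicator[OF C]) auto
    also have "\<dots> = C * measure M (\<Union>A\<in>P. A)"
      using P by (subst finite_measure_finite_Union)
        (auto simp: sum_distrib_left partition_on_def disjoint_family_on_def disjoint_def)
    also have "(\<Union>A\<in>P. A) = space M"
      using P by (auto simp: partition_on_def)
    finally show ?thesis .
  qed
  then show "\<exists>B. \<forall>P. finite P \<and> P \<subseteq> sets M \<and> partition_on (space M) P \<longrightarrow>
      (\<Sum>A\<in>P. norm (U (indicator A))) \<le> B"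
    by blast
qed

section \<open>Cutting operators to a set\<close>

lemma operator_diff:
  assumes "L1_operator M s V"
  shows "L1_operator M s (\<lambda>f. U f - V f)"
proof -
  interpret V: L1_operator M s V
    by fact
  show ?thesis
  proof (unfold_locales, goal_cases)
    case 1
    show ?case
      by (rule scaling)
  next
    case (2 f g)
    then show ?case
      by (simp add: add V.add)
  next
    case (3 f c)
    then show ?case
      by (simp add: scale V.scale s_diff_right)
  next
    case 4
    obtain C where C: "\<And>f. integrable M f \<Longrightarrow> norm (U f) \<le> C * (\<integral>x. norm (f x) \<partial>M)"
      using bound by blast
    obtain D where D: "\<And>f. integrable M f \<Longrightarrow> norm (V f) \<le> D * (\<integral>x. norm (f x) \<partial>M)"
      using V.bound by blast
    have "norm (U f - V f) \<le> (C + D) * (\<integral>x. norm (f x) \<partial>M)" if "integrable M f" for f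
      using norm_triangle_ineq4[of "U f" "V f"] C[OF that] D[OF that] by (simp add: algebra_simps)
    then show ?case
      by blast
  qed
qed

lemma integrable_cut: "A \<in> sets M \<Longrightarrow> integrable M f \<Longrightarrow> integrable M (\<lambda>x. indicat_real A x *\<^sub>R (f x :: 'k))"
  by (rule integrable_mult_indicator)

lemma norm_cut_le:
  assumes "A \<in> sets M" "integrable M f"
  shows "(\<integral>x. norm (indicat_real A x *\<^sub>R (f x :: 'k)) \<partial>M) \<le> (\<integral>x. norm (f x) \<partial>M)"
  using assms by (intro integral_mono integrable_norm integrable_cut) (auto simp: indicator_def)

lemma operator_cut:
  assumes A: "A \<in> sets M"
  shows "L1_operator M s (\<lambda>f. U (\<lambda>x. indicat_real A x *\<^sub>R f x))"
proof (unfold_locales, goal_cases)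
  case 1
  show ?case
    by (rule scaling)
next
  case (2 f g)
  then show ?case
    using add[OF integrable_cut[OF A] integrable_cut[OF A], of f g] by (simp add: scaleR_add_right)
next
  case (3 f c)
  then show ?case
    using scale[OF integrable_cut[OF A], of f c] by simp
next
  case 4
  obtain C where C0: "C \<ge> 0" and C: "\<And>f. integrable M f \<Longrightarrow> norm (U f) \<le> C * (\<integral>x. norm (f x) \<partial>M)"
    using bound by blast
  have "norm (U (\<lambda>x. indicat_real A x *\<^sub>R f x)) \<le> C * (\<integral>x. norm (f x) \<partial>M)" if "integrable M f" for f
    using C[OF integrable_cut[OF A that]] mult_left_mono[OF norm_cut_le[OF A that] C0] by linarith
  then show ?case
    by blast
qed

lemma operator_rank_one:
  assumes A: "A \<in> sets M"
  shows "L1_operator M s (\<lambda>f. s (\<integral>x. indicat_real A x *\<^sub>R f x \<partial>M) y)"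
proof (unfold_locales, goal_cases)
  case 1
  show ?case
    by (rule scaling)
next
  case (2 f g)
  then show ?case
    using integrable_cut[OF A] by (simp add: scaleR_add_right s_add_left)
next
  case (3 f c)
  have "(\<lambda>x. indicat_real A x *\<^sub>R (c * f x)) = (\<lambda>x. c * (indicat_real A x *\<^sub>R f x))"
    by simp
  then show ?case
    by (simp only: integral_mult_right_zero s_mult)
next
  case 4
  have "norm (s (\<integral>x. indicat_real A x *\<^sub>R f x \<partial>M) y) \<le> norm y * (\<integral>x. norm (f x) \<partial>M)"
    if "integrable M f" for f
    using integral_norm_bound[of M "\<lambda>x. indicat_real A x *\<^sub>R f x"] norm_cut_le[OF A that]
    by (simp add: s_norm mult.commute mult_left_mono)
  then show ?case
    by blast
qed

section \<open>Sets on which the density is almost constant\<close>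

text \<open>Since \<open>K\<close> is not a bound for \<open>U\<close>, the density \<open>g\<close> of \<open>U\<close> satisfies \<open>K < \<parallel>g\<parallel>\<close> on a set \<open>P\<close> of
  positive measure. A simple function \<open>t\<close> that is close to \<open>g\<close> in mean is within \<open>e\<close> of \<open>g\<close> on a
  non-null part of \<open>P\<close>, and one of its finitely many values is taken on a non-null part of that.
  The conclusion expresses the closeness of \<open>g\<close> to the constant through the values of \<open>U\<close> on
  indicators, the form in which \<open>norm_le\<close> takes it up.\<close>

lemma density_near_constant:
  assumes rnp: "RNP_on TYPE('a) TYPE('y)" and e: "0 < e"
    and K: "\<not> (\<forall>f. integrable M f \<longrightarrow> norm (U f) \<le> K * (\<integral>x. norm (f x) \<partial>M))"
  obtains A y where "A \<in> sets M" "0 < measure M A" "K - e < norm y"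
    "\<And>B. B \<in> sets M \<Longrightarrow> norm (U (indicator (B \<inter> A)) - measure M (B \<inter> A) *\<^sub>R y) \<le> e * measure M (B \<inter> A)"
proof -
  obtain g0 where g0: "\<And>A. A \<in> sets M \<Longrightarrow> has_Bochner M (\<lambda>x. indicator A x *\<^sub>R g0 x) (U (indicator A))"
    using rnp[unfolded RNP_on_def, rule_format, of M "\<lambda>A. U (indicator A)"]
      finite_measure_axioms vector_measure abs_cont bounded_variation by blast
  \<comment> \<open>Truncation to the space makes \<open>g\<close> itself, not only its products with indicators, measurable
    and approximable.\<close>
  define g where "g = (\<lambda>x. indicator (space M) x *\<^sub>R g0 x)"
  have g: "has_Bochner M (\<lambda>x. indicator A x *\<^sub>R g x) (U (indicator A))" if "A \<in> sets M" for A
  proof -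
    have "(\<lambda>x. indicator A x *\<^sub>R g x) = (\<lambda>x. indicator A x *\<^sub>R g0 x)"
      using sets.sets_into_space[OF that] by (auto simp: g_def fun_eq_iff split: split_indicator)
    then show ?thesis
      using g0[OF that] by simp
  qed
  have gB: "has_Bochner M g (U (indicator (space M)))"
    using g0[of "space M"] by (simp add: g_def)
  have simp_ind: "Bochner_Integration.simple_bochner_integrable M (\<lambda>x. indicator B x *\<^sub>R y)"
    "Bochner_Integration.simple_bochner_integral M (\<lambda>x. indicator B x *\<^sub>R y) = measure M B *\<^sub>R y"
    if B: "B \<in> sets M" for B and y :: 'y
  proof -
    have 1: "Bochner_Integration.simple_bochner_integrable M (indicat_real B)"
      using B by (auto simp: Bochner_Integration.simple_bochner_integrable.simps emeasure_eq_measure)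
    then show "Bochner_Integration.simple_bochner_integrable M (\<lambda>x. indicator B x *\<^sub>R y)"
      using Bochner_Integration.simple_bochner_integrable_compose2[OF _ 1 1, of "\<lambda>r _. r *\<^sub>R y"] by simp
    have "has_bochner_integral M (indicat_real B) (measure M B)"
      using B by (intro has_bochner_integral_real_indicator) (auto simp: emeasure_eq_measure)
    then have "Bochner_Integration.simple_bochner_integral M (indicat_real B) = measure M B"
      using has_bochner_integral_simple_bochner_integrable[OF 1] has_bochner_integral_eq by blast
    moreover have "linear (\<lambda>r. r *\<^sub>R y)"
      by (rule linear_scale_left)
    ultimately show "Bochner_Integration.simple_bochner_integral M (\<lambda>x. indicator B x *\<^sub>R y) = measure M B *\<^sub>R y"
      using Bochner_Integration.simple_bochner_integral_linear[of "\<lambda>r. r *\<^sub>R y", OF _ 1] by simp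
  qed
  have [measurable]: "(\<lambda>x. norm (g x)) \<in> borel_measurable M"
    using borel_measurable_norm_diff_simple[of g M "\<lambda>_. 0"] gB by (auto simp: has_Bochner_def)
  define P where "P = {x\<in>space M. K < norm (g x)}"
  have P[measurable]: "P \<in> sets M"
    unfolding P_def by measurable
  have "measure M P \<noteq> 0"
  proof
    assume P0: "measure M P = 0"
    have "norm (U (indicator B)) \<le> K * measure M B" if B[measurable]: "B \<in> sets M" for B
    proof -
      have "norm (U (indicator B)) \<le> (\<integral>\<^sup>+x. norm (indicator B x *\<^sub>R g x) \<partial>M)"
        using has_Bochner_norm_diff_le[OF g[OF B] simp_ind(1)[OF B, of 0]] simp_ind(2)[OF B, of 0] by simp
      also have "\<dots> \<le> (\<integral>\<^sup>+x. ennreal K * indicator B x \<partial>M)"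
      proof (rule nn_integral_mono_AE)
        have "AE x in M. x \<notin> P"
          using P0 P by (intro AE_not_in) (auto simp: null_sets_def emeasure_eq_measure)
        then show "AE x in M. ennreal (norm (indicator B x *\<^sub>R g x)) \<le> ennreal K * indicator B x"
          using AE_space by eventually_elim (auto simp: P_def indicator_def intro: ennreal_leI)
      qed
      also have "\<dots> = ennreal K * ennreal (measure M B)"
        by (simp add: nn_integral_cmult_indicator emeasure_eq_measure)
      finally have *: "ennreal (norm (U (indicator B))) \<le> ennreal K * ennreal (measure M B)" .
      show ?thesis
      proof (cases "0 \<le> K")
        case True
        then show ?thesis
          using * by (simp flip: ennreal_mult)
      next
        \<comment> \<open>For negative \<open>K\<close> the set \<open>P\<close> is the whole space, which is thus null.\<close>
        case False
        then have "K < norm (g x)" for x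
          using norm_ge_zero[of "g x"] by linarith
        then have "P = space M"
          by (simp add: P_def)
        then have "measure M B = 0"
          using P0 finite_measure_mono[of B "space M"] sets.sets_into_space[OF B] measure_nonneg[of M B] by simp
        then show ?thesis
          using * by simp
      qed
    qed
    then show False
      using K norm_le by blast
  qed
  then have Ppos: "0 < measure M P"
    by (simp add: zero_less_measure_iff)
  obtain t where t: "Bochner_Integration.simple_bochner_integrable M t"
    and te: "(\<integral>\<^sup>+x. norm (g x - t x) \<partial>M) < ennreal (e * measure M P)"
  proof -
    obtain s where s: "\<And>i::nat. Bochner_Integration.simple_bochner_integrable M (s i)"
      and s0: "(\<lambda>i. \<integral>\<^sup>+x. norm (g x - s i x) \<partial>M) \<longlonglongrightarrow> 0"
      using gB unfolding has_Bochner_def by blast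
    have "\<forall>\<^sub>F i in sequentially. (\<integral>\<^sup>+x. norm (g x - s i x) \<partial>M) < ennreal (e * measure M P)"
      using e Ppos by (intro order_tendstoD(2)[OF s0]) auto
    then show ?thesis
      using that s by (auto simp: eventually_sequentially)
  qed
  have ts: "simple_function M t"
    using t by (auto simp: Bochner_Integration.simple_bochner_integrable.simps)
  have gt[measurable]: "(\<lambda>x. norm (g x - t x)) \<in> borel_measurable M"
    using borel_measurable_norm_diff_simple[of g M t] gB ts by (auto simp: has_Bochner_def)
  define Q where "Q = {x\<in>space M. e \<le> norm (g x - t x)}"
  have Q[measurable]: "Q \<in> sets M"
    unfolding Q_def by measurable
  \<comment> \<open>Markov's inequality: the exceptional set \<open>Q\<close> is too small to cover \<open>P\<close>.\<close>
  have "ennreal (e * measure M Q) = (\<integral>\<^sup>+x. ennreal e * indicator Q x \<partial>M)"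
    using e by (simp add: nn_integral_cmult_indicator emeasure_eq_measure ennreal_mult)
  also have "\<dots> \<le> (\<integral>\<^sup>+x. norm (g x - t x) \<partial>M)"
    by (intro nn_integral_mono) (auto simp: Q_def indicator_def intro: ennreal_leI)
  also note te
  finally have "measure M Q < measure M P"
    using e by (simp add: ennreal_less_iff)
  then have PQ: "measure M (P - Q) \<noteq> 0"
    using finite_measure_mono[of P "(P - Q) \<union> Q"] measure_Un_le[of "P - Q" M Q] P Q by auto
  have tv[measurable]: "t -` {v} \<inter> space M \<in> sets M" for v
    using ts by (rule simple_functionD)
  obtain v where v: "measure M ((P - Q) \<inter> (t -` {v} \<inter> space M)) \<noteq> 0"
  proof (rule ccontr)
    assume "\<not> thesis"
    then have "measure M ((P - Q) \<inter> (t -` {v} \<inter> space M)) = 0" for v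
      using that by blast
    moreover have "P - Q = (\<Union>v\<in>t ` space M. (P - Q) \<inter> (t -` {v} \<inter> space M))"
      using sets.sets_into_space[OF P] by auto
    moreover have "measure M (\<Union>v\<in>t ` space M. (P - Q) \<inter> (t -` {v} \<inter> space M))
        \<le> (\<Sum>v\<in>t ` space M. measure M ((P - Q) \<inter> (t -` {v} \<inter> space M)))"
      using ts by (intro measure_UNION_le) (auto simp: simple_function_def)
    ultimately show False
      using PQ measure_nonneg[of M "P - Q"] by simp
  qed
  define A where "A = (P - Q) \<inter> (t -` {v} \<inter> space M)"
  have A: "A \<in> sets M"
    unfolding A_def by measurable
  have Apos: "0 < measure M A"
    using v by (simp add: A_def zero_less_measure_iff)
  have near: "K < norm (g x)" "norm (g x - v) < e" if "x \<in> A" for x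
    using that by (auto simp: A_def P_def Q_def)
  obtain x where "x \<in> A"
    using Apos by fastforce
  then have "K - e < norm v"
    using near[of x] norm_triangle_ineq2[of "g x" v] by linarith
  moreover have "norm (U (indicator (B \<inter> A)) - measure M (B \<inter> A) *\<^sub>R v) \<le> e * measure M (B \<inter> A)"
    if "B \<in> sets M" for B
  proof -
    have BA[measurable]: "B \<inter> A \<in> sets M"
      using that A by auto
    have "ennreal (norm (U (indicator (B \<inter> A)) - measure M (B \<inter> A) *\<^sub>R v))
        \<le> (\<integral>\<^sup>+x. norm (indicator (B \<inter> A) x *\<^sub>R g x - indicator (B \<inter> A) x *\<^sub>R v) \<partial>M)"
      using has_Bochner_norm_diff_le[OF g[OF BA] simp_ind(1)[OF BA, of v]] simp_ind(2)[OF BA, of v] by simp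
    also have "\<dots> \<le> (\<integral>\<^sup>+x. ennreal e * indicator (B \<inter> A) x \<partial>M)"
      using near(2) by (intro nn_integral_mono) (auto simp: indicator_def less_imp_le intro!: ennreal_leI)
    also have "\<dots> = ennreal (e * measure M (B \<inter> A))"
      using e by (simp add: nn_integral_cmult_indicator emeasure_eq_measure ennreal_mult)
    finally show ?thesis
      using e by simp
  qed
  ultimately show ?thesis
    using that A Apos by blast
qed

section \<open>Peaking operators\<close>

text \<open>The operator \<open>V\<close> has density \<open>y\<close> on \<open>A\<close> and that of \<open>U\<close> elsewhere. As \<open>norm y\<close> exceeds the
  bound \<open>N\<close> of \<open>U\<close>, each unit of mass of \<open>f\<close> outside \<open>A\<close> costs at least \<open>norm y - N\<close> in \<open>norm (V f)\<close>;
  this is the estimate \<open>V2\<close>, by which norming sequences lose that mass.\<close>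

lemma peaking_operator:
  fixes y :: 'y and A :: "'a set"
  defines "V \<equiv> \<lambda>f. U (\<lambda>x. indicat_real (space M - A) x *\<^sub>R f x) + s (\<integral>x. indicat_real A x *\<^sub>R f x \<partial>M) y"
    and "x0 \<equiv> \<lambda>x. indicator A x * of_real (1 / measure M A)"
  assumes A: "A \<in> sets M" and Apos: "0 < measure M A"
    and N: "\<And>f. integrable M f \<Longrightarrow> norm (U f) \<le> N * (\<integral>x. norm (f x) \<partial>M)" and Ny: "N < norm y"
  shows "integrable M x0" "(\<integral>x. norm (x0 x) \<partial>M) = 1" "V x0 = y"
    and "\<And>f. integrable M f \<Longrightarrow> norm (V f) \<le> norm y * (\<integral>x. norm (f x) \<partial>M)"
    and "\<And>x. (\<And>n::nat. integrable M (x n)) \<Longrightarrow> (\<And>n. (\<integral>w. norm (x n w) \<partial>M) \<le> 1) \<Longrightarrow>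
      (\<lambda>n. norm (V (x n))) \<longlonglongrightarrow> norm y \<Longrightarrow>
      \<exists>\<sigma> \<theta>. strict_mono \<sigma> \<and> norm \<theta> = 1 \<and> (\<lambda>n. V (x (\<sigma> n))) \<longlonglongrightarrow> s \<theta> y"
proof -
  have Ac: "space M - A \<in> sets M"
    using A by auto
  show x0: "integrable M x0"
    unfolding x0_def using integrable_indicator_field[OF A] by simp
  have "norm (x0 x) = indicator A x * (1 / measure M A)" for x
    using Apos by (simp add: x0_def norm_mult norm_divide indicator_def)
  then show "(\<integral>x. norm (x0 x) \<partial>M) = 1"
    using A sets.sets_into_space[OF A] Apos by (simp add: Int_absorb2)
  show "V x0 = y"
  proof -
    have "(\<lambda>x. indicat_real (space M - A) x *\<^sub>R x0 x) = (\<lambda>x. 0)"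
      by (auto simp: x0_def indicator_def)
    moreover have "(\<lambda>x. indicat_real A x *\<^sub>R x0 x) = x0"
      by (auto simp: x0_def indicator_def)
    moreover have "(\<integral>x. x0 x \<partial>M) = 1"
      unfolding x0_def integral_mult_left_zero integral_indicator_field[OF A] of_real_mult[symmetric] using Apos by simp
    ultimately show ?thesis
      unfolding V_def using zero s_of_real[of 1 y] by simp
  qed
  let ?a = "\<lambda>f. \<integral>x. norm (indicat_real (space M - A) x *\<^sub>R (f x :: 'k)) \<partial>M"
  let ?z = "\<lambda>f. \<integral>x. indicat_real A x *\<^sub>R (f x :: 'k) \<partial>M"
  have z: "norm (?z f) \<le> (\<integral>x. norm (f x) \<partial>M) - ?a f" if f: "integrable M f" for f
  proof -
    have "(\<integral>x. norm (f x) \<partial>M) = (\<integral>x. norm (indicat_real A x *\<^sub>R f x) + norm (indicat_real (space M - A) x *\<^sub>R f x) \<partial>M)"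
      by (intro Bochner_Integration.integral_cong) (auto simp: indicator_def)
    also have "\<dots> = (\<integral>x. norm (indicat_real A x *\<^sub>R f x) \<partial>M) + ?a f"
      using integrable_cut[OF A f] integrable_cut[OF Ac f] by (intro Bochner_Integration.integral_add integrable_norm)
    finally show ?thesis
      using integral_norm_bound[of M "\<lambda>x. indicat_real A x *\<^sub>R f x"] by linarith
  qed
  have V1: "norm (V f) \<le> N * ?a f + norm y * norm (?z f)" if f: "integrable M f" for f
    unfolding V_def using N[OF integrable_cut[OF Ac f]]
    by (intro norm_triangle_ineq[THEN order_trans]) (simp add: s_norm mult.commute)
  have V2: "norm (V f) \<le> norm y * (\<integral>x. norm (f x) \<partial>M) - (norm y - N) * ?a f" if f: "integrable M f" for f
  proof -
    have "norm y * norm (?z f) \<le> norm y * ((\<integral>x. norm (f x) \<partial>M) - ?a f)"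
      by (intro mult_left_mono z f) auto
    then show ?thesis
      using V1[OF f] by (simp add: algebra_simps)
  qed
  have a0: "0 \<le> ?a f" for f
    by simp
  show "norm (V f) \<le> norm y * (\<integral>x. norm (f x) \<partial>M)" if f: "integrable M f" for f
    using V2[OF f] mult_nonneg_nonneg[of "norm y - N" "?a f"] a0[of f] Ny by linarith
  have N0: "0 \<le> N"
    using order_trans[OF norm_ge_zero norm_indicator[OF N A]] Apos by (simp add: zero_le_mult_iff)
  have y0: "0 < norm y"
    using N0 Ny by linarith
  show "\<exists>\<sigma> \<theta>. strict_mono \<sigma> \<and> norm \<theta> = 1 \<and> (\<lambda>n. V (x (\<sigma> n))) \<longlonglongrightarrow> s \<theta> y"
    if xi: "\<And>n::nat. integrable M (x n)" and x1: "\<And>n. (\<integral>w. norm (x n w) \<partial>M) \<le> 1"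
      and lim: "(\<lambda>n. norm (V (x n))) \<longlonglongrightarrow> norm y" for x
  proof -
    have alim: "(\<lambda>n. ?a (x n)) \<longlonglongrightarrow> 0"
    proof (rule tendsto_sandwich[OF always_eventually always_eventually])
      show "\<forall>n. 0 \<le> ?a (x n)"
        by simp
      show "\<forall>n. ?a (x n) \<le> (norm y - norm (V (x n))) / (norm y - N)"
      proof
        fix n
        have "norm y * (\<integral>w. norm (x n w) \<partial>M) \<le> norm y * 1"
          by (intro mult_left_mono x1) auto
        then have "(norm y - N) * ?a (x n) \<le> norm y - norm (V (x n))"
          using V2[OF xi[of n]] by linarith
        then show "?a (x n) \<le> (norm y - norm (V (x n))) / (norm y - N)"
          using Ny by (simp add: pos_le_divide_eq mult.commute)
      qed
      have "(\<lambda>n. (norm y - norm (V (x n))) / (norm y - N)) \<longlonglongrightarrow> (norm y - norm y) / (norm y - N)"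
        using Ny by (intro tendsto_intros lim) auto
      then show "(\<lambda>n. (norm y - norm (V (x n))) / (norm y - N)) \<longlonglongrightarrow> 0"
        by simp
    qed simp
    \<comment> \<open>As the mass outside \<open>A\<close> vanishes in the limit, \<open>V1\<close> forces the moduli of the integrals
      over \<open>A\<close> to tend to 1.\<close>
    have zle: "norm (?z (x n)) \<le> 1" for n
      using z[OF xi[of n]] x1[of n] a0[of "x n"] by linarith
    have zlim: "(\<lambda>n. norm (?z (x n))) \<longlonglongrightarrow> 1"
    proof (rule tendsto_sandwich[OF always_eventually always_eventually])
      show "\<forall>n. (norm (V (x n)) - N * ?a (x n)) / norm y \<le> norm (?z (x n))"
        using V1[OF xi] y0 by (simp add: pos_divide_le_eq mult.commute algebra_simps)
      show "\<forall>n. norm (?z (x n)) \<le> 1"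
        using zle by blast
      have "(\<lambda>n. (norm (V (x n)) - N * ?a (x n)) / norm y) \<longlonglongrightarrow> (norm y - N * 0) / norm y"
        using y0 by (intro tendsto_intros lim alim) auto
      then show "(\<lambda>n. (norm (V (x n)) - N * ?a (x n)) / norm y) \<longlonglongrightarrow> 1"
        using y0 by simp
    qed simp
    have "bounded (range (\<lambda>n. ?z (x n)))"
      using zle by (auto simp: bounded_iff)
    then obtain \<theta> \<sigma> where \<sigma>: "strict_mono \<sigma>" and "((\<lambda>n. ?z (x n)) \<circ> \<sigma>) \<longlonglongrightarrow> \<theta>"
      using bounded_imp_convergent_subsequence by blast
    then have \<theta>: "(\<lambda>n. ?z (x (\<sigma> n))) \<longlonglongrightarrow> \<theta>"
      by (simp add: o_def)
    have "(\<lambda>n. norm (?z (x (\<sigma> n)))) \<longlonglongrightarrow> 1"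
      using LIMSEQ_subseq_LIMSEQ[OF zlim \<sigma>] by (simp add: o_def)
    with tendsto_norm[OF \<theta>] have \<theta>1: "norm \<theta> = 1"
      by (rule LIMSEQ_unique)
    have "(\<lambda>n. V (x (\<sigma> n)) - s \<theta> y) \<longlonglongrightarrow> 0"
    proof (rule Lim_null_comparison[OF always_eventually])
      show "\<forall>n. norm (V (x (\<sigma> n)) - s \<theta> y) \<le> N * ?a (x (\<sigma> n)) + norm (?z (x (\<sigma> n)) - \<theta>) * norm y"
      proof
        fix n
        have "V (x (\<sigma> n)) - s \<theta> y
            = U (\<lambda>w. indicat_real (space M - A) w *\<^sub>R x (\<sigma> n) w) + s (?z (x (\<sigma> n)) - \<theta>) y"
          by (simp add: V_def s_diff_left)
        then show "norm (V (x (\<sigma> n)) - s \<theta> y) \<le> N * ?a (x (\<sigma> n)) + norm (?z (x (\<sigma> n)) - \<theta>) * norm y"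
          using N[OF integrable_cut[OF Ac xi[of "\<sigma> n"]]] s_norm
          by (metis (no_types, lifting) add_right_mono norm_triangle_ineq order_trans)
      qed
      have "(\<lambda>n. N * ?a (x (\<sigma> n)) + norm (?z (x (\<sigma> n)) - \<theta>) * norm y) \<longlonglongrightarrow> N * 0 + norm (\<theta> - \<theta>) * norm y"
        using LIMSEQ_subseq_LIMSEQ[OF alim \<sigma>] by (intro tendsto_intros \<theta>) (simp add: o_def)
      then show "(\<lambda>n. N * ?a (x (\<sigma> n)) + norm (?z (x (\<sigma> n)) - \<theta>) * norm y) \<longlonglongrightarrow> 0"
        by simp
    qed
    then have "(\<lambda>n. V (x (\<sigma> n))) \<longlonglongrightarrow> s \<theta> y"
      by (simp add: LIM_zero_iff)
    then show ?thesis
      using \<sigma> \<theta>1 by blast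
  qed
qed

text \<open>Lowering a bound in steps of \<open>e\<close> must fail at some point, since a negative number is not a
  bound on a space of positive measure. The result is a number within \<open>e\<close> of the operator norm.\<close>

lemma almost_optimal_bound:
  assumes pos: "0 < measure M (space M)" and e: "0 < e"
  obtains N where "\<And>f. integrable M f \<Longrightarrow> norm (U f) \<le> N * (\<integral>x. norm (f x) \<partial>M)"
    "\<not> (\<forall>f. integrable M f \<longrightarrow> norm (U f) \<le> (N - e) * (\<integral>x. norm (f x) \<partial>M))"
proof -
  obtain C where C: "\<And>f. integrable M f \<Longrightarrow> norm (U f) \<le> C * (\<integral>x. norm (f x) \<partial>M)"
    using bound by blast
  let ?P = "\<lambda>n. \<forall>f. integrable M f \<longrightarrow> norm (U f) \<le> (C - real n * e) * (\<integral>x. norm (f x) \<partial>M)"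
  obtain n where "C < real n * e"
    using ex_less_of_nat_mult[OF e] by blast
  have "\<not> ?P n"
  proof
    assume P: "?P n"
    have "norm (U (indicator (space M))) \<le> (C - real n * e) * measure M (space M)"
      using P by (intro norm_indicator) auto
    moreover have "(C - real n * e) * measure M (space M) < 0"
      using \<open>C < real n * e\<close> pos by (intro mult_neg_pos) auto
    ultimately show False
      using norm_ge_zero[of "U (indicator (space M))"] by linarith
  qed
  moreover have "?P 0"
    using C by simp
  ultimately obtain m where "?P m" "\<not> ?P (Suc m)"
    using nat_induct[of ?P] by blast
  then show ?thesis
    using that[of "C - real m * e"] by (simp add: algebra_simps)
qed

text \<open>With a bound \<open>N\<close> that is optimal up to \<open>d\<close>, the value \<open>y\<close> near the density on \<open>A\<close> has norm above
  \<open>N - 2 * d\<close>. Prolonging it by \<open>3 * d\<close> in its own direction lifts the norm above \<open>N\<close>. The operator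
  changes by at most \<open>d\<close> through replacing the density by \<open>y\<close> on \<open>A\<close>, and by \<open>3 * d\<close> through the
  prolongation.\<close>

lemma approximation_by_peaking:
  assumes rnp: "RNP_on TYPE('a) TYPE('y)" and nz: "\<exists>y :: 'y. y \<noteq> 0"
    and pos: "0 < measure M (space M)" and e: "0 < e"
  obtains V x0 where "L1_operator M s V"
    "\<And>f. integrable M f \<Longrightarrow> norm (U f - V f) \<le> e * (\<integral>x. norm (f x) \<partial>M)"
    "integrable M x0" "(\<integral>x. norm (x0 x) \<partial>M) = 1"
    "\<And>f. integrable M f \<Longrightarrow> norm (V f) \<le> norm (V x0) * (\<integral>x. norm (f x) \<partial>M)"
    "\<And>x. (\<And>n::nat. integrable M (x n)) \<Longrightarrow> (\<And>n. (\<integral>w. norm (x n w) \<partial>M) \<le> 1) \<Longrightarrow>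
      (\<lambda>n. norm (V (x n))) \<longlonglongrightarrow> norm (V x0) \<Longrightarrow>
      \<exists>\<sigma> \<theta>. strict_mono \<sigma> \<and> norm \<theta> = 1 \<and> (\<lambda>n. V (x (\<sigma> n))) \<longlonglongrightarrow> s \<theta> (V x0)"
proof -
  define d where "d = e / 4"
  have d: "0 < d"
    using e by (simp add: d_def)
  obtain N where N: "\<And>f. integrable M f \<Longrightarrow> norm (U f) \<le> N * (\<integral>x. norm (f x) \<partial>M)"
    and Nd: "\<not> (\<forall>f. integrable M f \<longrightarrow> norm (U f) \<le> (N - d) * (\<integral>x. norm (f x) \<partial>M))"
    using almost_optimal_bound[OF pos d] by blast
  obtain A y where A: "A \<in> sets M" "0 < measure M A" and y: "N - d - d < norm y"
    and near: "\<And>B. B \<in> sets M \<Longrightarrow>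
      norm (U (indicator (B \<inter> A)) - measure M (B \<inter> A) *\<^sub>R y) \<le> d * measure M (B \<inter> A)"
    using density_near_constant[OF rnp d Nd] by blast
  have Ac: "space M - A \<in> sets M"
    using A by auto
  \<comment> \<open>The direction \<open>u\<close> of \<open>y\<close>; if \<open>y = 0\<close>, which may happen for a small operator, any unit vector
    serves.\<close>
  obtain u :: 'y where u: "norm u = 1" "norm (y + (3 * d) *\<^sub>R u) = norm y + 3 * d"
  proof (cases "y = 0")
    case True
    obtain z :: 'y where "z \<noteq> 0"
      using nz by blast
    then show ?thesis
      using that[of "z /\<^sub>R norm z"] True d by simp
  next
    case False
    have "y + (3 * d) *\<^sub>R (y /\<^sub>R norm y) = (1 + 3 * d / norm y) *\<^sub>R y"
      by (simp add: scaleR_add_left divide_inverse)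
    then have "norm (y + (3 * d) *\<^sub>R (y /\<^sub>R norm y)) = (1 + 3 * d / norm y) * norm y"
      using d by simp
    also have "\<dots> = norm y + 3 * d"
      using False by (simp add: field_simps)
    finally show ?thesis
      using that[of "y /\<^sub>R norm y"] False by simp
  qed
  define y' where "y' = y + (3 * d) *\<^sub>R u"
  have Ny': "N < norm y'"
    using u y d by (simp add: y'_def)
  define V where "V = (\<lambda>f. U (\<lambda>x. indicat_real (space M - A) x *\<^sub>R f x) + s (\<integral>x. indicat_real A x *\<^sub>R f x \<partial>M) y')"
  define x0 where "x0 = (\<lambda>x. indicator A x * of_real (1 / measure M A) :: 'k)"
  interpret W: L1_operator M s "\<lambda>f. U (\<lambda>x. indicat_real A x *\<^sub>R f x) - s (\<integral>x. indicat_real A x *\<^sub>R f x \<partial>M) y"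
    by (rule L1_operator.operator_diff[OF operator_cut[OF A(1)] operator_rank_one[OF A(1)]])
  have split: "U f = U (\<lambda>x. indicat_real (space M - A) x *\<^sub>R f x) + U (\<lambda>x. indicat_real A x *\<^sub>R f x)"
    if f: "integrable M f" for f
  proof -
    have "U f = U (\<lambda>x. indicat_real (space M - A) x *\<^sub>R f x + indicat_real A x *\<^sub>R f x)"
      using f by (intro cong) (auto simp: indicator_def)
    also have "\<dots> = U (\<lambda>x. indicat_real (space M - A) x *\<^sub>R f x) + U (\<lambda>x. indicat_real A x *\<^sub>R f x)"
      by (intro add integrable_cut A Ac f)
    finally show ?thesis .
  qed
  have UV: "U f - V f = U (\<lambda>x. indicat_real A x *\<^sub>R f x) - s (\<integral>x. indicat_real A x *\<^sub>R f x \<partial>M) y'"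
    if "integrable M f" for f
    using split[OF that] by (simp add: V_def)
  have opV: "L1_operator M s V"
  proof -
    have "L1_operator M s (\<lambda>f. U (\<lambda>x. indicat_real (space M - A) x *\<^sub>R f x) - s (\<integral>x. indicat_real A x *\<^sub>R f x \<partial>M) (- y'))"
      by (rule L1_operator.operator_diff[OF operator_cut[OF Ac] operator_rank_one[OF A(1)]])
    moreover have "s c (- y') = - s c y'" for c
      using s_diff_right[of c 0 y'] s_diff_right[of c 0 0] by simp
    ultimately show ?thesis
      by (simp add: V_def)
  qed
  have close: "norm (U f - V f) \<le> e * (\<integral>x. norm (f x) \<partial>M)" if f: "integrable M f" for f
  proof -
    let ?z = "\<integral>x. indicat_real A x *\<^sub>R f x \<partial>M"
    have W: "norm (U (\<lambda>x. indicat_real A x *\<^sub>R f x) - s ?z y) \<le> d * (\<integral>x. norm (f x) \<partial>M)"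
    proof (rule W.norm_le[OF _ f])
      fix B assume B: "B \<in> sets M"
      have 1: "(\<lambda>x. indicat_real A x *\<^sub>R indicator B x) = (indicator (B \<inter> A) :: 'a \<Rightarrow> 'k)"
        by (auto simp: indicator_def)
      have 2: "(\<integral>x. (indicator (B \<inter> A) x :: 'k) \<partial>M) = of_real (measure M (B \<inter> A))"
        using B A by (intro integral_indicator_field) auto
      have "norm (U (indicator (B \<inter> A)) - measure M (B \<inter> A) *\<^sub>R y) \<le> d * measure M B"
        using near[OF B] finite_measure_mono[OF Int_lower1 B, of A] d
        by (meson less_imp_le mult_left_mono order_trans)
      then show "norm (U (\<lambda>x. indicat_real A x *\<^sub>R indicator B x)
          - s (\<integral>x. indicat_real A x *\<^sub>R indicator B x \<partial>M) y) \<le> d * measure M B"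
        by (simp only: 1 2 s_of_real)
    qed
    have eq: "U f - V f = (U (\<lambda>x. indicat_real A x *\<^sub>R f x) - s ?z y) - s ?z ((3 * d) *\<^sub>R u)"
      using UV[OF f] by (simp add: y'_def s_add_right)
    have rest: "norm (s ?z ((3 * d) *\<^sub>R u)) \<le> 3 * d * (\<integral>x. norm (f x) \<partial>M)"
      using integral_norm_bound[of M "\<lambda>x. indicat_real A x *\<^sub>R f x"] norm_cut_le[OF A(1) f] d u(1)
      by (simp add: s_norm mult.commute mult_left_mono)
    have "norm (U f - V f) \<le> d * (\<integral>x. norm (f x) \<partial>M) + 3 * d * (\<integral>x. norm (f x) \<partial>M)"
      unfolding eq by (rule order_trans[OF norm_triangle_ineq4 add_mono[OF W rest]])
    then show ?thesis
      by (simp add: d_def algebra_simps)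
  qed
  have peak: "V x0 = y'"
    unfolding V_def x0_def by (rule peaking_operator(3)[OF A N Ny'])
  show ?thesis
  proof (rule that[OF opV close])
    show "integrable M x0"
      unfolding x0_def by (rule peaking_operator(1)[OF A N Ny'])
    show "(\<integral>x. norm (x0 x) \<partial>M) = 1"
      unfolding x0_def by (rule peaking_operator(2)[OF A N Ny'])
    show "norm (V f) \<le> norm (V x0) * (\<integral>x. norm (f x) \<partial>M)" if "integrable M f" for f
      unfolding peak unfolding V_def by (rule peaking_operator(4)[OF A N Ny' that])
    fix x assume x: "\<And>n::nat. integrable M (x n)" "\<And>n. (\<integral>w. norm (x n w) \<partial>M) \<le> 1"
      and lim: "(\<lambda>n. norm (V (x n))) \<longlonglongrightarrow> norm (V x0)"
    show "\<exists>\<sigma> \<theta>. strict_mono \<sigma> \<and> norm \<theta> = 1 \<and> (\<lambda>n. V (x (\<sigma> n))) \<longlonglongrightarrow> s \<theta> (V x0)"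
      unfolding peak unfolding V_def
      by (rule peaking_operator(5)[OF A N Ny' x lim[unfolded peak, unfolded V_def]])
  qed
qed

end

section \<open>Passage to classes\<close>

lemma L1_operator_of_bdd_operator:
  fixes M :: "'a measure" and s :: "'k::{real_normed_field, euclidean_space} \<Rightarrow> 'y::banach \<Rightarrow> 'y"
  assumes M: "finite_measure M" and s: "normed_scaling s" and T: "T \<in> bdd_operators (L1 M) s"
  shows "L1_operator M s (\<lambda>f. T (ae_eq M `` {f}))"
proof -
  interpret finite_measure M
    by fact
  have car: "ae_eq M `` {f} \<in> car (L1 M)" if "integrable M f" for f :: "'a \<Rightarrow> 'k"
    using that L1_car by blast
  show ?thesis
  proof (unfold_locales, goal_cases)
    case 1
    show ?case
      by (rule s)
  next
    case (2 f g)
    then show ?case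
      using T car by (auto simp: bdd_operators_def simp flip: L1_add)
  next
    case (3 f c)
    then show ?case
      using T car by (auto simp: bdd_operators_def simp flip: L1_scl)
  next
    case 4
    obtain C where "\<forall>u\<in>car (L1 M). norm (T u) \<le> C * nrm (L1 M) u"
      using T by (auto simp: bdd_operators_def)
    then have "\<forall>f. integrable M f \<longrightarrow> norm (T (ae_eq M `` {f})) \<le> C * (\<integral>x. norm (f x) \<partial>M)"
      using car by (metis L1_nrm)
    then show ?case
      by blast
  qed
qed

context L1_operator
begin

definition class_op :: "('a \<Rightarrow> 'k) set \<Rightarrow> 'y" where
  "class_op u = U (SOME f. f \<in> u)"

lemma class_op: 
  assumes f: "integrable M f"
  shows "class_op (ae_eq M `` {f}) = U f"
proof -
  define g where "g = (SOME g. g \<in> ae_eq M `` {f})"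
  have "f \<in> ae_eq M `` {f}"
    using f by (simp add: ae_eq_def)
  then have "g \<in> ae_eq M `` {f}"
    unfolding g_def by (rule someI[of "\<lambda>g. g \<in> ae_eq M `` {f}"])
  then have "integrable M g" "AE x in M. f x = g x"
    by (auto simp: ae_eq_def)
  then have "U f = U g"
    using f by (intro cong_AE)
  then show ?thesis
    by (simp add: class_op_def g_def)
qed

lemma class_op_bdd: "class_op \<in> bdd_operators (L1 M) s"
proof -
  obtain C where C: "\<And>f. integrable M f \<Longrightarrow> norm (U f) \<le> C * (\<integral>x. norm (f x) \<partial>M)"
    using bound by blast
  show ?thesis
    unfolding bdd_operators_def
  proof (intro CollectI conjI ballI allI exI[of _ C])
    fix u v :: "('a \<Rightarrow> 'k) set" assume "u \<in> car (L1 M)" "v \<in> car (L1 M)"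
    then show "class_op (nspace.add (L1 M) u v) = class_op u + class_op v"
      by (auto simp: L1_car L1_add class_op add)
  next
    fix c and u :: "('a \<Rightarrow> 'k) set" assume "u \<in> car (L1 M)"
    then show "class_op (scl (L1 M) c u) = s c (class_op u)"
      by (auto simp: L1_car L1_scl class_op scale)
  next
    fix u :: "('a \<Rightarrow> 'k) set" assume "u \<in> car (L1 M)"
    then show "norm (class_op u) \<le> C * nrm (L1 M) u"
      by (auto simp: L1_car L1_nrm class_op C)
  qed
qed

end

lemma op_norm_le:
  fixes T :: "('a \<Rightarrow> 'k::{real_normed_field, euclidean_space}) set \<Rightarrow> 'y::banach"
  assumes "0 \<le> C" and C: "\<And>f. integrable M f \<Longrightarrow> norm (T (ae_eq M `` {f})) \<le> C * (\<integral>x. norm (f x) \<partial>M)"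
  shows "op_norm (L1 M) T \<le> C"
  unfolding op_norm_def
proof (rule cSUP_least)
  have "ae_eq M `` {\<lambda>x. 0 :: 'k} \<in> {u \<in> car (L1 M). nrm (L1 M) u \<le> 1}"
    by (auto simp: L1_car L1_nrm)
  then show "{u \<in> car (L1 M :: ('k, ('a \<Rightarrow> 'k) set) nspace). nrm (L1 M) u \<le> 1} \<noteq> {}"
    by blast
  fix u assume u: "u \<in> {u \<in> car (L1 M :: ('k, ('a \<Rightarrow> 'k) set) nspace). nrm (L1 M) u \<le> 1}"
  then obtain f where f: "integrable M f" "u = ae_eq M `` {f}"
    by (auto simp: L1_car)
  then show "norm (T u) \<le> C"
    using C[OF f(1)] u mult_left_mono[of "\<integral>x. norm (f x) \<partial>M" 1 C] \<open>0 \<le> C\<close> by (simp add: L1_nrm)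
qed

text \<open>The peaking operators attain their norm, which makes their operator norm explicit.\<close>

lemma op_norm_attained:
  fixes T :: "('a \<Rightarrow> 'k::{real_normed_field, euclidean_space}) set \<Rightarrow> 'y::banach"
  assumes C: "\<And>f. integrable M f \<Longrightarrow> norm (T (ae_eq M `` {f})) \<le> norm (T (ae_eq M `` {x0})) * (\<integral>x. norm (f x) \<partial>M)"
    and x0: "integrable M x0" "(\<integral>x. norm (x0 x) \<partial>M) = 1"
  shows "op_norm (L1 M) T = norm (T (ae_eq M `` {x0}))"
  unfolding op_norm_def
proof (rule cSup_eq_maximum)
  show "norm (T (ae_eq M `` {x0})) \<in> (\<lambda>u. norm (T u)) ` {u \<in> car (L1 M). nrm (L1 M) u \<le> 1}"
    using x0 by (auto simp: L1_car L1_nrm)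
  fix r assume "r \<in> (\<lambda>u. norm (T u)) ` {u \<in> car (L1 M). nrm (L1 M) u \<le> 1}"
  then obtain f where f: "integrable M f" "r = norm (T (ae_eq M `` {f}))" "(\<integral>x. norm (f x) \<partial>M) \<le> 1"
    by (auto simp: L1_car L1_nrm)
  then show "r \<le> norm (T (ae_eq M `` {x0}))"
    using C[OF f(1)] mult_left_mono[OF f(3), of "norm (T (ae_eq M `` {x0}))"] by simp
qed

text \<open>A sequence of classes is represented by a sequence of functions, and the normalised indicator
  of the peak set is the point \<open>x\<^sub>0\<close> of the definition of range strongly exposing operators.\<close>

theorem RSE_dense:
  fixes M :: "'a measure" and s :: "'k::{real_normed_field, euclidean_space} \<Rightarrow> 'y::banach \<Rightarrow> 'y"
  assumes M: "finite_measure M" and nz: "\<exists>y :: 'y. y \<noteq> 0" and rnp: "RNP_on TYPE('a) TYPE('y)"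
    and s: "normed_scaling s" and nzX: "nonzero_space (L1 M :: ('k, ('a \<Rightarrow> 'k) set) nspace)"
  shows "op_norm_dense (L1 M) (RSE (L1 M) s) (bdd_operators (L1 M) s)"
  unfolding op_norm_dense_def
proof (intro conjI ballI allI impI)
  show "RSE (L1 M) s \<subseteq> bdd_operators (L1 M) s"
    by (auto simp: RSE_def)
  fix T and e :: real assume T: "T \<in> bdd_operators (L1 M) s" and e: "0 < e"
  interpret T: L1_operator M s "\<lambda>f. T (ae_eq M `` {f})"
    by (rule L1_operator_of_bdd_operator[OF M s T])
  have pos: "0 < measure M (space M)"
  proof (rule ccontr)
    assume "\<not> 0 < measure M (space M)"
    then have "AE x in M. False"
      by (simp add: AE_iff_measurable[of "space M"] T.emeasure_eq_measure zero_less_measure_iff)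
    then have "(\<integral>x. norm (f x) \<partial>M) = 0" for f :: "'a \<Rightarrow> 'k"
      by (intro integral_eq_zero_AE) auto
    then show False
      using nzX by (auto simp: nonzero_space_def L1_car L1_nrm)
  qed
  obtain V x0 where V: "L1_operator M s V"
    and close: "\<And>f. integrable M f \<Longrightarrow> norm (T (ae_eq M `` {f}) - V f) \<le> (e / 2) * (\<integral>x. norm (f x) \<partial>M)"
    and x0: "integrable M x0" "(\<integral>x. norm (x0 x) \<partial>M) = 1"
    and max: "\<And>f. integrable M f \<Longrightarrow> norm (V f) \<le> norm (V x0) * (\<integral>x. norm (f x) \<partial>M)"
    and exposes: "\<And>x. (\<And>n::nat. integrable M (x n)) \<Longrightarrow> (\<And>n. (\<integral>w. norm (x n w) \<partial>M) \<le> 1) \<Longrightarrow>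
      (\<lambda>n. norm (V (x n))) \<longlonglongrightarrow> norm (V x0) \<Longrightarrow>
      \<exists>\<sigma> \<theta>. strict_mono \<sigma> \<and> norm \<theta> = 1 \<and> (\<lambda>n. V (x (\<sigma> n))) \<longlonglongrightarrow> s \<theta> (V x0)"
    using T.approximation_by_peaking[OF rnp nz pos half_gt_zero[OF e]] by blast
  interpret V: L1_operator M s V
    by (rule V)
  show "\<exists>S\<in>RSE (L1 M) s. op_norm (L1 M) (\<lambda>u. T u - S u) < e"
  proof
    have "op_norm (L1 M) (\<lambda>u. T u - V.class_op u) \<le> e / 2"
      using e close by (intro op_norm_le) (auto simp: V.class_op)
    then show "op_norm (L1 M) (\<lambda>u. T u - V.class_op u) < e"
      using e by simp
    have nrm: "op_norm (L1 M) V.class_op = norm (V x0)"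
      using op_norm_attained[of M V.class_op x0] x0 max by (simp add: V.class_op)
    show "V.class_op \<in> RSE (L1 M) s"
      unfolding RSE_def
    proof (intro CollectI conjI V.class_op_bdd bexI[of _ "ae_eq M `` {x0}"] allI impI)
      show "ae_eq M `` {x0} \<in> car (L1 M)" "nrm (L1 M) (ae_eq M `` {x0}) = 1"
        using x0 by (auto simp: L1_car L1_nrm)
      fix u :: "nat \<Rightarrow> ('a \<Rightarrow> 'k) set"
      assume u: "(\<forall>n. u n \<in> car (L1 M) \<and> nrm (L1 M) (u n) \<le> 1)
        \<and> (\<lambda>n. norm (V.class_op (u n))) \<longlonglongrightarrow> op_norm (L1 M) V.class_op"
      then obtain x where x: "\<And>n. integrable M (x n)" "\<And>n. u n = ae_eq M `` {x n}"
        unfolding L1_car by metis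
      have "\<exists>\<sigma> \<theta>. strict_mono \<sigma> \<and> norm \<theta> = 1 \<and> (\<lambda>n. V (x (\<sigma> n))) \<longlonglongrightarrow> s \<theta> (V x0)"
        using u x by (intro exposes) (auto simp: V.class_op L1_nrm nrm)
      then show "\<exists>\<sigma> \<theta>. strict_mono \<sigma> \<and> norm \<theta> = 1 \<and>
          (\<lambda>n. V.class_op (u (\<sigma> n))) \<longlonglongrightarrow> s \<theta> (V.class_op (ae_eq M `` {x0}))"
        using x x0 by (simp add: V.class_op)
    qed
  qed
qed

theorem corollary3p8:
  fixes M :: "'a measure"
  assumes "finite_measure M"
    and "\<exists>y :: 'y::banach. y \<noteq> 0"
    and "RNP_on TYPE('a) TYPE('y)" and "RNP_on TYPE(real) TYPE('y)"
  shows
    "(nonzero_space (L1 M :: (real, ('a \<Rightarrow> real) set) nspace) \<longrightarrow>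
        op_norm_dense (L1 M) (RSE (L1 M) (scaleR :: real \<Rightarrow> 'y \<Rightarrow> 'y)) (bdd_operators (L1 M) scaleR))
     \<and>
     (\<forall>scaleC :: complex \<Rightarrow> 'y \<Rightarrow> 'y.
        normed_scaling scaleC \<and> nonzero_space (L1 M :: (complex, ('a \<Rightarrow> complex) set) nspace) \<longrightarrow>
        op_norm_dense (L1 M) (RSE (L1 M) scaleC) (bdd_operators (L1 M) scaleC))"
proof -
  have "normed_scaling (scaleR :: real \<Rightarrow> 'y \<Rightarrow> 'y)"
    by (simp add: normed_scaling_def real_vector.vector_space_axioms)
  then show ?thesis
    using RSE_dense[OF assms(1-3), of "scaleR :: real \<Rightarrow> 'y \<Rightarrow> 'y"]
      RSE_dense[OF assms(1-3), where 'k = complex] by (intro conjI allI impI) simp_all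
qed

end
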